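(* Let $n,m\in\mathbb{N}$ and $x\in X$. (1) There is a unique decomposition $x=v_{n,m}+u_{n,m}$ with $v_{n,m}\in R(A_{n,m}^*A)$ and $u_{n,m}\in N(A_{n,m}^*A)$. Moreover, $v_{n,m}=A_{n,m}^\dagger Ax$. (2) There is a unique decomposition $x=\overline v_{n,m}+\overline u_{n,m}$ with $\overline v_{n,m}\in R(A^*A_{n,m})$ and $\overline u_{n,m}\in N(A^*A_{n,m})$, and a unique decomposition $x=\overline v_{n,m}+\overline w_{n,m}+\overline q_{n,m}$ with (the same) $\overline v_{n,m}\in R(A^*A_{n,m})$, $\overline w_{n,m}\in N(Q_mA)\cap X_n$ and $\overline q_{n,m}\in X_n^\perp$. Moreover, $\overline v_{n,m}=A^*(A_{n,m}^* )^\dagger x$ and $\overline w_{n,m}=\Pi_{N(Q_mA)\cap X_n}x$.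
   Context: $X,Y$ are Hilbert spaces and $A:X\to Y$ is a bounded linear operator. $(X_n)_{n\in\mathbb{N}}$ and $(Y_m)_{m\in\mathbb{N}}$ are sequences of finite-dimensional subspaces $X_n\subset X$, $Y_m\subset Y$ with $X_n\subset X_{n+1}$, $\overline{\bigcup_n X_n}=X$, $Y_m\subset Y_{m+1}$, $\overline{\bigcup_m Y_m}=Y$. $P_n$ is the orthogonal projector of $X$ onto $X_n$ and $Q_m$ the orthogonal projector of $Y$ onto $Y_m$. $A_{n,m}:=Q_mAP_n:X\to Y$, and $A_{n,m}^*=P_nA^*Q_m$ is its adjoint. $N(T)$ and $R(T)$ denote nullspace and range of an operator $T$, and $T^\dagger$ the Moore–Penrose pseudoinverse of an operator $T$ with closed range ($T^\dagger y$ is the minimum-norm least-squares solution of $Tx=y$). $\Pi_Z$ denotes the orthogonal projector onto a closed subspace $Z$. *)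

theory Defs
  imports "HOL-Analysis.Analysis"
begin

text \<open>Scalars, treated uniformly for the real and the complex field. The law \<open>mult_kcnj\<close> determines
  the conjugation away from 0. By the Gelfand-Mazur theorem a commutative real normed division
  algebra is a copy of the reals or of the complex numbers, so the class has no other models.\<close>

class real_or_complex = real_normed_field +
  fixes kcnj :: "'a \<Rightarrow> 'a"
  assumes kcnj_add: "kcnj (x + y) = kcnj x + kcnj y"
    and kcnj_mult: "kcnj (x * y) = kcnj x * kcnj y"
    and mult_kcnj: "x * kcnj x = (norm x)\<^sup>2 *\<^sub>R 1"

instantiation real :: real_or_complex
begin
definition kcnj_real :: "real \<Rightarrow> real" where "kcnj_real x = x"
instance
  by standard (simp_all add: kcnj_real_def power2_eq_square)
end

instantiation complex :: real_or_complex
begin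
definition kcnj_complex :: "complex \<Rightarrow> complex" where "kcnj_complex = cnj"
instance
  by standard (simp_all add: kcnj_complex_def scaleR_conv_of_real complex_norm_square del: of_real_power)
end

text \<open>A Hilbert space over \<open>'k\<close>, with an inner product that is linear in its first argument. Norm,
  topology and completeness are those of the type; \<open>ip_self\<close> ties them to the inner product.\<close>

locale hilbert_space = vector_space scale
  for scale :: "'k::real_or_complex \<Rightarrow> 'a::{real_normed_vector, complete_space} \<Rightarrow> 'a" +
  fixes ip :: "'a \<Rightarrow> 'a \<Rightarrow> 'k"
  assumes scale_of_real: "scale (of_real r) x = r *\<^sub>R x"
    and ip_add_left: "ip (x + y) z = ip x z + ip y z"
    and ip_scale_left: "ip (scale c x) y = c * ip x y"
    and ip_commute: "ip y x = kcnj (ip x y)"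
    and ip_self: "ip x x = of_real ((norm x)\<^sup>2)"

lemma hilbert_space_real:
  "hilbert_space scaleR (inner :: 'a::{real_inner, complete_space} \<Rightarrow> 'a \<Rightarrow> real)"
  by unfold_locales
    (simp_all add: algebra_simps inner_commute kcnj_real_def power2_norm_eq_inner)

lemma hilbert_space_complex: "hilbert_space (*) (\<lambda>x y. x * cnj y)"
  by unfold_locales
    (simp_all add: algebra_simps kcnj_complex_def scaleR_conv_of_real complex_norm_square
      del: of_real_power)

definition fin_dim_subspace :: "('k::field \<Rightarrow> 'a::ab_group_add \<Rightarrow> 'a) \<Rightarrow> 'a set \<Rightarrow> bool" where
  "fin_dim_subspace scl S \<longleftrightarrow> (\<exists>B. finite B \<and> S = module.span scl B)"

definition bounded_op ::
  "('k::field \<Rightarrow> 'a::real_normed_vector \<Rightarrow> 'a) \<Rightarrow> ('k \<Rightarrow> 'b::real_normed_vector \<Rightarrow> 'b)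
    \<Rightarrow> ('a \<Rightarrow> 'b) \<Rightarrow> bool" where
  "bounded_op scaleX scaleY T \<longleftrightarrow> Vector_Spaces.linear scaleX scaleY T \<and> bounded_linear T"

definition nullspace :: "('a \<Rightarrow> 'b::zero) \<Rightarrow> 'a set" where
  "nullspace T = {x. T x = 0}"

definition ortho_compl :: "('a \<Rightarrow> 'a \<Rightarrow> 'k::zero) \<Rightarrow> 'a set \<Rightarrow> 'a set" where
  "ortho_compl ip Z = {x. \<forall>z\<in>Z. ip x z = 0}"

definition ortho_proj :: "('a::ab_group_add \<Rightarrow> 'a \<Rightarrow> 'k::zero) \<Rightarrow> 'a set \<Rightarrow> 'a \<Rightarrow> 'a" where
  "ortho_proj ip Z x = (THE z. z \<in> Z \<and> x - z \<in> ortho_compl ip Z)"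

definition hadjoint ::
  "('a \<Rightarrow> 'a \<Rightarrow> 'k) \<Rightarrow> ('b \<Rightarrow> 'b \<Rightarrow> 'k) \<Rightarrow> ('a \<Rightarrow> 'b) \<Rightarrow> 'b \<Rightarrow> 'a" where
  "hadjoint ipX ipY T = (THE T'. \<forall>x y. ipY (T x) y = ipX x (T' y))"

definition least_squares_sol ::
  "('a \<Rightarrow> 'b::real_normed_vector) \<Rightarrow> 'b \<Rightarrow> 'a \<Rightarrow> bool" where
  "least_squares_sol T y x \<longleftrightarrow> (\<forall>z. norm (T x - y) \<le> norm (T z - y))"

definition pseudoinverse ::
  "('a::real_normed_vector \<Rightarrow> 'b::real_normed_vector) \<Rightarrow> 'b \<Rightarrow> 'a" where
  "pseudoinverse T y =
     (THE x. least_squares_sol T y x \<and> (\<forall>z. least_squares_sol T y z \<longrightarrow> norm x \<le> norm z))"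

end

theory Submission
  imports Defs
begin

text \<open>Put \<open>B = Q A P\<close> and \<open>B\<^sup>* = P A\<^sup>* Q\<close>, both of finite rank. A finite-rank adjoint pair \<open>T\<close>, \<open>T'\<close> splits
  its domain as \<open>R(T') \<oplus> N(T)\<close>, and \<open>T\<^sup>\<dagger> y\<close> is the only \<open>v \<in> R(T')\<close> with \<open>T' T v = T' y\<close>. All claims
  follow from this, applied to \<open>(B, B\<^sup>*)\<close> and \<open>(B\<^sup>*, B)\<close>, because \<open>B\<^sup>* A\<close> agrees with \<open>B\<^sup>* B\<close> on \<open>X\<^sub>n\<close> and
  \<open>B A\<^sup>*\<close> agrees with \<open>B B\<^sup>*\<close> on \<open>Y\<^sub>m\<close>.\<close>

section \<open>Hilbert spaces over the real or complex scalars\<close>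

lemma kcnj_0 [simp]: "kcnj (0::'k::real_or_complex) = 0"
  using kcnj_add[of "0::'k" 0] by simp

lemma kcnj_eq_0_iff [simp]: "kcnj (c::'k::real_or_complex) = 0 \<longleftrightarrow> c = 0"
  using mult_kcnj[of c] by auto

text \<open>The law \<open>mult_kcnj\<close> gives r times its conjugate as r squared, and a nonzero
  r cancels; zero is its own case.\<close>

lemma kcnj_of_real [simp]: "kcnj (of_real r :: 'k::real_or_complex) = of_real r"
proof (cases "r = 0")
  case False
  have "of_real r * kcnj (of_real r :: 'k) = of_real r * of_real r"
    by (simp add: mult_kcnj power2_eq_square scaleR_conv_of_real)
  with False show ?thesis by simp
qed simp

context hilbert_space
begin

lemma ip_zero_left [simp]: "ip 0 y = 0"
  using ip_add_left[of 0 0 y] by simp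

lemma ip_diff_left: "ip (x - y) z = ip x z - ip y z"
  using ip_add_left[of "x - y" y z] by simp

lemma ip_add_right: "ip z (x + y) = ip z x + ip z y"
  by (metis ip_add_left ip_commute kcnj_add)

lemma ip_zero_right [simp]: "ip y 0 = 0"
  by (metis ip_zero_left ip_commute kcnj_0)

lemma ip_diff_right: "ip z (x - y) = ip z x - ip z y"
  using ip_add_right[of z "x - y" y] by simp

lemma ip_scale_right: "ip x (scale c y) = kcnj c * ip x y"
  by (metis ip_scale_left ip_commute kcnj_mult)

lemma ip_eq_0_commute: "ip x y = 0 \<longleftrightarrow> ip y x = 0"
  by (metis ip_commute kcnj_0)

lemma ip_self_eq_0_iff [simp]: "ip x x = 0 \<longleftrightarrow> x = 0"
  by (simp add: ip_self)

lemma ip_ext_left: "(\<And>z. ip x z = ip y z) \<Longrightarrow> x = y"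
  by (metis eq_iff_diff_eq_0 ip_diff_left ip_self_eq_0_iff)

lemma ip_ext_right: "(\<And>z. ip z x = ip z y) \<Longrightarrow> x = y"
  by (metis eq_iff_diff_eq_0 ip_diff_right ip_self_eq_0_iff)

text \<open>The norm of the type comes with homogeneity for real factors only. For factors in
  \<open>'k\<close> it is read off from the inner product of the scaled vector with itself.\<close>

lemma norm_scale: "norm (scale c x) = norm c * norm x"
proof -
  have "(of_real ((norm (scale c x))\<^sup>2) :: 'k) = of_real ((norm c * norm x)\<^sup>2)"
  proof -
    have "ip (scale c x) (scale c x) = (c * kcnj c) * ip x x"
      by (simp add: ip_scale_left ip_scale_right)
    then show ?thesis
      by (simp add: ip_self mult_kcnj scaleR_conv_of_real power_mult_distrib)
  qed
  then show ?thesis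
    by (simp only: of_real_eq_iff) (simp add: power2_eq_iff_nonneg)
qed

lemma pythagoras:
  assumes "ip x y = 0"
  shows "(norm (x + y))\<^sup>2 = (norm x)\<^sup>2 + (norm y)\<^sup>2"
proof -
  have "ip y x = 0" using assms ip_eq_0_commute by blast
  then have "(of_real ((norm (x + y))\<^sup>2) :: 'k) = of_real ((norm x)\<^sup>2 + (norm y)\<^sup>2)"
    using assms by (simp only: ip_self[symmetric] ip_add_left ip_add_right of_real_add) simp
  then show ?thesis by (simp only: of_real_eq_iff)
qed

lemma parallelogram:
  fixes x y :: 'a
  shows "(norm (x + y))\<^sup>2 + (norm (x - y))\<^sup>2 = 2 * (norm x)\<^sup>2 + 2 * (norm y)\<^sup>2"
proof -
  have "ip (x + y) (x + y) + ip (x - y) (x - y) = ip x x + ip x x + (ip y y + ip y y)"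
    by (simp add: ip_add_left ip_add_right ip_diff_left ip_diff_right)
  then have "(norm (x + y))\<^sup>2 + (norm (x - y))\<^sup>2
      = (norm x)\<^sup>2 + (norm x)\<^sup>2 + ((norm y)\<^sup>2 + (norm y)\<^sup>2)"
    by (simp only: ip_self of_real_add[symmetric] of_real_eq_iff)
  then show ?thesis by simp
qed

text \<open>What remains of \<open>x\<close> after removing its component along \<open>y\<close>.
  This is the one-dimensional projection behind Cauchy-Schwarz, the minimal-norm argument and the
  Gram-Schmidt step.\<close>

lemma ip_residual: "ip (x - scale (ip x y / ip y y) y) y = 0"
  by (cases "y = 0") (simp_all add: ip_diff_left ip_scale_left)

text \<open>By Pythagoras the component of \<open>x\<close> along \<open>y\<close> is no longer than
  \<open>x\<close>.\<close>

lemma Cauchy_Schwarz: "norm (ip x y) \<le> norm x * norm y"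
proof (cases "y = 0")
  case False
  define c where "c = ip x y / ip y y"
  have "ip (x - scale c y) (scale c y) = 0"
    using ip_residual[of x y] by (simp add: ip_scale_right c_def)
  from pythagoras[OF this] have "(norm (scale c y))\<^sup>2 \<le> (norm x)\<^sup>2" by simp
  then have "norm c * norm y \<le> norm x" by (simp add: norm_scale power2_le_iff_abs_le)
  moreover have "norm c = norm (ip x y) / (norm y)\<^sup>2"
    by (simp add: c_def norm_divide ip_self norm_power)
  ultimately show ?thesis using False
    by (simp add: power2_eq_square field_simps)
qed simp

lemma bounded_linear_ip_left: "bounded_linear (\<lambda>x. ip x y)"
proof (rule bounded_linear_intro)
  show "ip (r *\<^sub>R x) y = r *\<^sub>R ip x y" for r x
    by (simp add: scale_of_real[symmetric] ip_scale_left scaleR_conv_of_real)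
qed (rule ip_add_left Cauchy_Schwarz)+

section \<open>Vectors of minimal norm and the Riesz representation\<close>

text \<open>Removing the component of \<open>e\<close> along \<open>h\<close> shortens
  \<open>e\<close> unless that component is zero. It serves both the Riesz theorem and the normal
  equations.\<close>

lemma min_norm_imp_orthogonal:
  assumes "\<And>c. norm e \<le> norm (e - scale c h)"
  shows "ip e h = 0"
proof -
  define c where "c = ip e h / ip h h"
  define p where "p = e - scale c h"
  have ph: "ip p h = 0" unfolding p_def c_def by (rule ip_residual)
  then have "ip p (scale c h) = 0" by (simp add: ip_scale_right)
  from pythagoras[OF this] have "(norm e)\<^sup>2 = (norm p)\<^sup>2 + (norm (scale c h))\<^sup>2"
    by (simp add: p_def)
  moreover have "(norm e)\<^sup>2 \<le> (norm p)\<^sup>2"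
    using assms[of c] by (simp add: p_def)
  ultimately have "scale c h = 0" by simp
  with ph show ?thesis by (simp add: p_def)
qed

text \<open>A minimizing sequence is Cauchy by the parallelogram law; completeness gives its limit,
  and closedness keeps the limit in \<open>S\<close>.\<close>

lemma min_norm_ex:
  fixes S :: "'a set"
  assumes cl: "closed S" and ne: "S \<noteq> {}"
    and mid: "\<And>x y. x \<in> S \<Longrightarrow> y \<in> S \<Longrightarrow> (1/2) *\<^sub>R (x + y) \<in> S"
  shows "\<exists>e\<in>S. \<forall>z\<in>S. norm e \<le> norm z"
proof -
  define D where "D = (INF z\<in>S. (norm z)\<^sup>2)"
  have bdd: "bdd_below ((\<lambda>z. (norm z)\<^sup>2) ` S)" by (rule bdd_belowI2[of _ 0]) simp
  have D_le: "D \<le> (norm z)\<^sup>2" if "z \<in> S" for z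
    unfolding D_def using bdd that by (rule cINF_lower)
  have "\<exists>z\<in>S. (norm z)\<^sup>2 < D + inverse (real (Suc k))" for k
    using cInf_lessD[of "(\<lambda>z. (norm z)\<^sup>2) ` S" "D + inverse (real (Suc k))"] ne
    by (auto simp: D_def)
  then obtain s where s: "\<And>k. s k \<in> S" "\<And>k. (norm (s k))\<^sup>2 < D + inverse (real (Suc k))"
    by metis
  \<comment> \<open>The midpoint lies in \<open>S\<close>, so the squared norm of
    \<open>s k + s l\<close> is at least \<open>4 * D\<close>, which cancels the \<open>D\<close>
    terms in the parallelogram law.\<close>
  have gap: "(norm (s k - s l))\<^sup>2 \<le> 2 * inverse (real (Suc k)) + 2 * inverse (real (Suc l))" for k l
  proof -
    have "D \<le> (norm ((1/2) *\<^sub>R (s k + s l)))\<^sup>2" by (intro D_le mid s)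
    also have "\<dots> = (norm (s k + s l))\<^sup>2 / 4" by (simp add: power_divide)
    finally show ?thesis
      using parallelogram[of "s k" "s l"] s(2)[of k] s(2)[of l] by linarith
  qed
  have "Cauchy s"
  proof (rule metric_CauchyI)
    fix r :: real assume r: "0 < r"
    \<comment> \<open>For indices from \<open>N\<close> on, the bound \<open>gap\<close> is at most
      four times this inverse, hence below the square of \<open>r\<close>.\<close>
    then obtain N where N: "inverse (real (Suc N)) < r\<^sup>2 / 4"
      using reals_Archimedean[of "r\<^sup>2 / 4"] by auto
    have "dist (s k) (s l) < r" if kl: "k \<ge> N" "l \<ge> N" for k l
    proof -
      have "inverse (real (Suc k)) \<le> inverse (real (Suc N))"
        "inverse (real (Suc l)) \<le> inverse (real (Suc N))"
        using kl by (auto intro!: le_imp_inverse_le)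
      with gap[of k l] N have "(norm (s k - s l))\<^sup>2 < r\<^sup>2" by linarith
      with r show ?thesis by (simp add: dist_norm power_less_imp_less_base)
    qed
    then show "\<exists>N. \<forall>k\<ge>N. \<forall>l\<ge>N. dist (s k) (s l) < r" by blast
  qed
  then obtain e where e: "s \<longlonglongrightarrow> e"
    using Cauchy_convergent convergent_def by blast
  have "e \<in> S" using cl s(1) e by (rule closed_sequentially)
  moreover have "(norm e)\<^sup>2 \<le> D"
  proof (rule LIMSEQ_le)
    show "(\<lambda>k. (norm (s k))\<^sup>2) \<longlonglongrightarrow> (norm e)\<^sup>2" by (intro tendsto_intros e)
    show "(\<lambda>k. D + inverse (real (Suc k))) \<longlonglongrightarrow> D"
      by (rule LIMSEQ_inverse_real_of_nat_add)
    show "\<exists>N. \<forall>k\<ge>N. (norm (s k))\<^sup>2 \<le> D + inverse (real (Suc k))"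
      using s(2) less_imp_le by blast
  qed
  ultimately show ?thesis
    using D_le by (meson norm_ge_zero order_trans power2_le_imp_le)
qed

text \<open>For nonzero \<open>f\<close>, the shortest \<open>e\<close> with \<open>f e = 1\<close>
  is orthogonal to the kernel of \<open>f\<close>. Since \<open>z - scale (f z) e\<close> lies in
  that kernel, \<open>e\<close> divided by its squared norm represents \<open>f\<close>.\<close>

theorem Riesz_representation:
  assumes bl: "bounded_linear f" and f_scale: "\<And>c z. f (scale c z) = c * f z"
  shows "\<exists>a. \<forall>z. f z = ip z a"
proof (cases "\<forall>z. f z = 0")
  case True
  then show ?thesis by (intro exI[of _ 0]) simp
next
  case False
  interpret f: bounded_linear f by (rule bl)
  from False obtain z0 where z0: "f z0 \<noteq> 0" by blast
  have "closed {z. f z = 1}"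
    by (intro closed_Collect_eq continuous_intros linear_continuous_on bl)
  moreover have "scale (inverse (f z0)) z0 \<in> {z. f z = 1}" using z0 by (simp add: f_scale)
  moreover have "(1/2) *\<^sub>R (x + y) \<in> {z. f z = 1}" if "x \<in> {z. f z = 1}" "y \<in> {z. f z = 1}" for x y
    using that by (simp add: f.scaleR f.add) (simp add: scaleR_conv_of_real)
  ultimately obtain e where e: "f e = 1" "\<And>z. f z = 1 \<Longrightarrow> norm e \<le> norm z"
    using min_norm_ex[of "{z. f z = 1}"] by blast
  \<comment> \<open>Moving \<open>e\<close> along the kernel keeps \<open>f = 1\<close>, so
    \<open>e\<close> stays the shortest vector along \<open>h\<close>.\<close>
  have orth: "ip e h = 0" if "f h = 0" for h
    by (rule min_norm_imp_orthogonal, rule e) (simp add: f.diff f_scale that e)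
  have "f z = ip z (scale (of_real (1 / (norm e)\<^sup>2)) e)" for z
  proof -
    have "ip (z - scale (f z) e) e = 0"
      by (subst ip_eq_0_commute, rule orth) (simp add: f.diff f_scale e)
    then have "ip z e = f z * of_real ((norm e)\<^sup>2)"
      by (simp add: ip_diff_left ip_scale_left ip_self)
    moreover have "e \<noteq> 0" using e(1) f.zero by auto
    ultimately show ?thesis
      unfolding ip_scale_right kcnj_of_real by simp
  qed
  then show ?thesis by blast
qed

section \<open>Orthogonal projection onto finite-dimensional subspaces\<close>

text \<open>The difference of two candidates lies in \<open>Z\<close> and is orthogonal to itself.
  The form for sets closed under differences covers the \<open>X n\<close> as well as their
  intersection with a nullspace.\<close>

lemma ortho_proj_eq:
  assumes "\<And>y z. y \<in> Z \<Longrightarrow> z \<in> Z \<Longrightarrow> y - z \<in> Z"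
    and "z \<in> Z" and "x - z \<in> ortho_compl ip Z"
  shows "ortho_proj ip Z x = z"
  unfolding ortho_proj_def
proof (rule the_equality)
  fix z' assume z': "z' \<in> Z \<and> x - z' \<in> ortho_compl ip Z"
  then have mem: "z' - z \<in> Z" using assms by blast
  have "ip (z' - z) (z' - z) = ip (x - z) (z' - z) - ip (x - z') (z' - z)"
    by (simp add: ip_diff_left)
  also have "\<dots> = 0" using mem assms(3) z' by (simp add: ortho_compl_def)
  finally show "z' = z" by simp
qed (use assms in blast)

text \<open>Induction on the generators, one Gram-Schmidt step at a time; no completeness is involved.\<close>

lemma ortho_decomp_ex:
  assumes "finite G"
  shows "\<exists>z\<in>span G. \<forall>y\<in>span G. ip (x - z) y = 0"
  using assms
proof (induction G arbitrary: x)
  case (insert b G)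
  obtain b' where b': "b' \<in> span G" "\<And>y. y \<in> span G \<Longrightarrow> ip (b - b') y = 0"
    using insert.IH[of b] by blast
  obtain z where z: "z \<in> span G" "\<And>y. y \<in> span G \<Longrightarrow> ip (x - z) y = 0"
    using insert.IH[of x] by blast
  \<comment> \<open>The new Gram-Schmidt direction: \<open>b\<close> minus its projection onto
    \<open>span G\<close>. It is 0 when \<open>b\<close> already lies in that span, and then the
    correction \<open>scale c e\<close> vanishes.\<close>
  define e where "e = b - b'"
  define c where "c = ip (x - z) e / ip e e"
  have e_perp: "ip e y = 0" if "y \<in> span G" for y
    using b'(2)[OF that] by (simp add: e_def)
  have sub: "span G \<subseteq> span (insert b G)" by (intro span_mono) auto
  have "e \<in> span (insert b G)"
    unfolding e_def using b'(1) sub by (intro span_diff) (auto intro: span_base)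
  then have mem: "z + scale c e \<in> span (insert b G)"
    using z(1) sub by (intro span_add span_scale) auto
  have "ip (x - (z + scale c e)) y = 0" if y: "y \<in> span (insert b G)" for y
  proof -
    obtain k where k: "y - scale k b \<in> span G" using y span_breakdown_eq by blast
    \<comment> \<open>Substituting \<open>b = e + b'\<close> splits \<open>y\<close> into a part in
      \<open>span G\<close> and a multiple of \<open>e\<close>.\<close>
    define g where "g = y - scale k b + scale k b'"
    have g: "g \<in> span G" unfolding g_def using k b'(1) by (intro span_add span_scale)
    have y_eq: "y = g + scale k e" by (simp add: g_def e_def scale_right_diff_distrib)
    have res: "x - (z + scale c e) = x - z - scale c e" by simp
    have "ip (x - (z + scale c e)) e = 0"
      unfolding res unfolding c_def by (rule ip_residual)
    moreover have "ip (x - (z + scale c e)) g = 0"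
      unfolding res by (subst ip_diff_left) (simp add: ip_scale_left e_perp g z(2))
    ultimately show ?thesis by (simp add: y_eq ip_add_right ip_scale_right)
  qed
  with mem show ?case by blast
qed simp

lemma fin_dim_subspace_ortho_decomp:
  assumes "fin_dim_subspace scale S"
  obtains z where "z \<in> S" "\<And>y. y \<in> S \<Longrightarrow> ip (x - z) y = 0"
  using assms ortho_decomp_ex unfolding fin_dim_subspace_def by blast

lemma fin_dim_subspace_diff:
  "fin_dim_subspace scale S \<Longrightarrow> y \<in> S \<Longrightarrow> z \<in> S \<Longrightarrow> y - z \<in> S"
  unfolding fin_dim_subspace_def using span_diff by blast

context
  fixes S assumes S: "fin_dim_subspace scale S"
begin

lemma ortho_proj_fin_dim: "ortho_proj ip S x \<in> S" "y \<in> S \<Longrightarrow> ip (x - ortho_proj ip S x) y = 0"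
proof -
  obtain z where z: "z \<in> S" "\<And>y. y \<in> S \<Longrightarrow> ip (x - z) y = 0"
    using fin_dim_subspace_ortho_decomp[OF S] by blast
  then have "ortho_proj ip S x = z"
    by (intro ortho_proj_eq fin_dim_subspace_diff[OF S]) (auto simp: ortho_compl_def)
  with z show "ortho_proj ip S x \<in> S" "y \<in> S \<Longrightarrow> ip (x - ortho_proj ip S x) y = 0" by auto
qed

lemma ortho_proj_ident: "x \<in> S \<Longrightarrow> ortho_proj ip S x = x"
  by (intro ortho_proj_eq fin_dim_subspace_diff[OF S]) (auto simp: ortho_compl_def)

lemma range_ortho_proj: "range (ortho_proj ip S) = S"
  using ortho_proj_fin_dim(1) ortho_proj_ident by (metis rangeI image_subsetI subsetI subset_antisym)

text \<open>Both sides equal the inner product of the two projections.\<close>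

lemma ortho_proj_self_adjoint: "ip (ortho_proj ip S x) y = ip x (ortho_proj ip S y)"
proof -
  let ?P = "ortho_proj ip S"
  have "ip (x - ?P x) (?P y) = 0" by (intro ortho_proj_fin_dim)
  moreover have "ip (?P x) (y - ?P y) = 0"
    by (subst ip_eq_0_commute) (intro ortho_proj_fin_dim)
  ultimately show ?thesis by (simp add: ip_diff_left ip_diff_right)
qed

end

end

section \<open>Adjoint pairs\<close>

text \<open>Keeping both maps as parameters makes the notion symmetric: by \<open>swap\<close>, each
  fact about \<open>T\<close> is available for \<open>T'\<close> too.\<close>

locale adjoint_pair = X: hilbert_space scaleX ipX + Y: hilbert_space scaleY ipY
  for scaleX :: "'k::real_or_complex \<Rightarrow> 'a::{real_normed_vector, complete_space} \<Rightarrow> 'a" and ipX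
    and scaleY :: "'k \<Rightarrow> 'b::{real_normed_vector, complete_space} \<Rightarrow> 'b" and ipY +
  fixes T :: "'a \<Rightarrow> 'b" and T' :: "'b \<Rightarrow> 'a"
  assumes adjoint: "ipY (T x) y = ipX x (T' y)"
begin

lemma swap: "adjoint_pair scaleY ipY scaleX ipX T' T"
  by unfold_locales (metis adjoint X.ip_commute Y.ip_commute)

lemma linear: "Vector_Spaces.linear scaleX scaleY T"
proof (unfold_locales)
  show "T (x + y) = T x + T y" for x y
    by (rule Y.ip_ext_left) (simp add: adjoint X.ip_add_left Y.ip_add_left)
  show "T (scaleX c x) = scaleY c (T x)" for c x
    by (rule Y.ip_ext_left) (simp add: adjoint X.ip_scale_left Y.ip_scale_left)
qed

sublocale T: Vector_Spaces.linear scaleX scaleY T by (rule linear)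

text \<open>Inner products separate points, so the adjoint identity has \<open>T'\<close> as its
  only solution and the definite description picks it.\<close>

lemma hadjoint_eq: "hadjoint ipX ipY T = T'"
  unfolding hadjoint_def
proof (rule the_equality)
  fix S assume "\<forall>x y. ipY (T x) y = ipX x (S y)"
  then show "S = T'" by (intro ext X.ip_ext_right) (simp add: adjoint[symmetric])
qed (simp add: adjoint)

lemma normal_eq_0: "T' (T x) = 0 \<Longrightarrow> T x = 0"
  using adjoint[of x "T x"] by simp

lemma range_adjoint_perp_null: "T x = 0 \<Longrightarrow> ipX x (T' y) = 0"
  using adjoint[of x y] by simp

section \<open>Normal equations and the pseudoinverse\<close>

text \<open>The residual \<open>T x - y\<close> lies in the nullspace of \<open>T'\<close>, hence is
  orthogonal to the range of \<open>T\<close>; Pythagoras does the rest.\<close>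

lemma normal_eq_imp_least_squares:
  assumes "T' (T x) = T' y"
  shows "least_squares_sol T y x"
  unfolding least_squares_sol_def
proof
  fix z
  interpret S: adjoint_pair scaleY ipY scaleX ipX T' T by (rule swap)
  have "ipY (T x - y) (T z - T x) = 0"
    using S.adjoint[of "T x - y" "z - x"] assms by (simp add: T.diff S.T.diff)
  from Y.pythagoras[OF this] have "(norm (T x - y))\<^sup>2 \<le> (norm (T z - y))\<^sup>2" by simp
  then show "norm (T x - y) \<le> norm (T z - y)" by (simp add: power2_le_iff_abs_le)
qed

text \<open>Comparing \<open>x\<close> with \<open>x - scaleX c z\<close> for all \<open>c\<close>
  shows that the residual is orthogonal to every \<open>T z\<close>.\<close>

lemma least_squares_imp_normal_eq:
  assumes "least_squares_sol T y x"
  shows "T' (T x) = T' y"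
proof -
  interpret S: adjoint_pair scaleY ipY scaleX ipX T' T by (rule swap)
  have "ipX (T' (T x - y)) z = ipX 0 z" for z
  proof -
    have "norm (T x - y) \<le> norm (T x - y - scaleY c (T z))" for c
      using assms[unfolded least_squares_sol_def, rule_format, of "x - scaleX c z"]
      by (simp add: T.diff T.scale algebra_simps)
    then have "ipY (T x - y) (T z) = 0" by (rule Y.min_norm_imp_orthogonal)
    then show ?thesis by (simp add: S.adjoint)
  qed
  then have "T' (T x - y) = 0" by (rule X.ip_ext_left)
  then show ?thesis by (simp add: S.T.diff)
qed

text \<open>Any least-squares solution differs from \<open>v\<close> by an element of the nullspace
  of \<open>T\<close>. That difference is orthogonal to \<open>v\<close>, so \<open>v\<close> is the
  only shortest solution.\<close>

lemma pseudoinverse_eq: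
  assumes v: "v \<in> range T'" and ne: "T' (T v) = T' y"
  shows "pseudoinverse T y = v"
proof -
  interpret S: adjoint_pair scaleY ipY scaleX ipX T' T by (rule swap)
  have split: "(norm z)\<^sup>2 = (norm v)\<^sup>2 + (norm (z - v))\<^sup>2" if "least_squares_sol T y z" for z
  proof -
    have "T' (T (z - v)) = 0"
      using least_squares_imp_normal_eq[OF that] ne by (simp add: T.diff S.T.diff)
    then have "ipX (z - v) v = 0" using normal_eq_0 range_adjoint_perp_null v by blast
    then have "ipX v (z - v) = 0" by (subst X.ip_eq_0_commute)
    from X.pythagoras[OF this] show ?thesis by simp
  qed
  show ?thesis
    unfolding pseudoinverse_def
  proof (rule the_equality)
    have "norm v \<le> norm z" if "least_squares_sol T y z" for z
      using split[OF that] by (simp add: power2_le_imp_le)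
    then show "least_squares_sol T y v \<and> (\<forall>z. least_squares_sol T y z \<longrightarrow> norm v \<le> norm z)"
      using normal_eq_imp_least_squares[OF ne] by blast
    fix z assume z: "least_squares_sol T y z \<and> (\<forall>z'. least_squares_sol T y z' \<longrightarrow> norm z \<le> norm z')"
    then have "norm z \<le> norm v" using normal_eq_imp_least_squares[OF ne] by blast
    then have "(norm z)\<^sup>2 \<le> (norm v)\<^sup>2" by simp
    with split z have "(norm (z - v))\<^sup>2 \<le> 0" by (metis add_le_same_cancel1)
    then show "z = v" by simp
  qed
qed

end

section \<open>Adjoint pairs of finite rank\<close>

locale finite_rank_adjoint_pair = adjoint_pair +
  assumes fin_dim_range: "fin_dim_subspace scaleY (range T)"
    and fin_dim_range_adjoint: "fin_dim_subspace scaleX (range T')"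
begin

lemma finite_rank_swap: "finite_rank_adjoint_pair scaleY ipY scaleX ipX T' T"
  by (intro finite_rank_adjoint_pair.intro swap finite_rank_adjoint_pair_axioms.intro
      fin_dim_range fin_dim_range_adjoint)

text \<open>Project \<open>x\<close> onto the range of \<open>T'\<close>. The residual is orthogonal
  to \<open>T' (T (x - v))\<close>, which makes the norm of \<open>T (x - v)\<close> zero.\<close>

lemma range_adjoint_null_decomp:
  obtains v where "v \<in> range T'" "T (x - v) = 0"
proof -
  obtain v where v: "v \<in> range T'" "\<And>y. y \<in> range T' \<Longrightarrow> ipX (x - v) y = 0"
    using X.fin_dim_subspace_ortho_decomp[OF fin_dim_range_adjoint] by blast
  then have "ipY (T (x - v)) (T (x - v)) = 0" by (subst adjoint) simp
  then have "T (x - v) = 0" by simp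
  with v(1) show thesis by (rule that)
qed

text \<open>Splitting \<open>y\<close> along the range of \<open>T\<close> and the nullspace of
  \<open>T'\<close> gives a solution \<open>z\<close>; only its component in the range of
  \<open>T'\<close> is kept.\<close>

lemma normal_eq_solution:
  obtains v where "v \<in> range T'" "T' (T v) = T' y"
proof -
  interpret S: finite_rank_adjoint_pair scaleY ipY scaleX ipX T' T by (rule finite_rank_swap)
  obtain z where z: "T' (y - T z) = 0"
    using S.range_adjoint_null_decomp[of y] by blast
  obtain v where v: "v \<in> range T'" "T (z - v) = 0"
    using range_adjoint_null_decomp[of z] by blast
  from v(2) have "T v = T z" by (simp add: T.diff)
  with z have "T' (T v) = T' y" by (simp add: S.T.diff)
  with v(1) show thesis by (rule that)
qed

end

lemma fin_dim_subspace_linear_image: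
  assumes "Vector_Spaces.linear scaleX scaleY f" "fin_dim_subspace scaleX S"
  shows "fin_dim_subspace scaleY (f ` S)"
proof -
  interpret Vector_Spaces.linear scaleX scaleY f by (rule assms)
  show ?thesis
    using assms(2) span_image unfolding fin_dim_subspace_def by (metis finite_imageI)
qed

lemma adjoint_pair_comp:
  assumes "adjoint_pair scaleX ipX scaleY ipY S S'" "adjoint_pair scaleY ipY scaleZ ipZ T T'"
  shows "adjoint_pair scaleX ipX scaleZ ipZ (T \<circ> S) (S' \<circ> T')"
  using assms unfolding adjoint_pair_def adjoint_pair_axioms_def by simp

lemma (in hilbert_space) adjoint_pair_ortho_proj:
  "fin_dim_subspace scale S \<Longrightarrow>
    adjoint_pair scale ip scale ip (ortho_proj ip S) (ortho_proj ip S)"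
  by unfold_locales (rule ortho_proj_self_adjoint)

text \<open>Riesz applied to the functional \<open>ipY (A x) y\<close> of \<open>x\<close> supplies
  an adjoint, which uniqueness identifies with \<open>hadjoint\<close>.\<close>

lemma adjoint_pair_hadjoint:
  assumes hX: "hilbert_space scaleX ipX" and hY: "hilbert_space scaleY ipY"
    and A: "bounded_op scaleX scaleY A"
  shows "adjoint_pair scaleX ipX scaleY ipY A (hadjoint ipX ipY A)"
proof -
  interpret X: hilbert_space scaleX ipX by (rule hX)
  interpret Y: hilbert_space scaleY ipY by (rule hY)
  interpret A: Vector_Spaces.linear scaleX scaleY A using A by (simp add: bounded_op_def)
  have "bounded_linear A" using A by (simp add: bounded_op_def)
  then have "\<exists>a. \<forall>x. ipY (A x) y = ipX x a" for y
    by (intro X.Riesz_representation bounded_linear_compose[OF Y.bounded_linear_ip_left])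
      (simp_all add: A.scale Y.ip_scale_left)
  then obtain A' where "\<And>x y. ipY (A x) y = ipX x (A' y)" by metis
  then have pair: "adjoint_pair scaleX ipX scaleY ipY A A'"
    by unfold_locales
  with adjoint_pair.hadjoint_eq[OF pair] show ?thesis by simp
qed

section \<open>The decompositions\<close>

theorem proposition11:
  fixes scaleX :: "'k::real_or_complex \<Rightarrow> 'a::{real_normed_vector, complete_space} \<Rightarrow> 'a" and ipX :: "'a \<Rightarrow> 'a \<Rightarrow> 'k"
    and scaleY :: "'k \<Rightarrow> 'b::{real_normed_vector, complete_space} \<Rightarrow> 'b" and ipY :: "'b \<Rightarrow> 'b \<Rightarrow> 'k"
    and A :: "'a \<Rightarrow> 'b" and X :: "nat \<Rightarrow> 'a set" and Y :: "nat \<Rightarrow> 'b set"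
    and n m :: nat and x :: 'a
  assumes "hilbert_space scaleX ipX" and "hilbert_space scaleY ipY"
    and "bounded_op scaleX scaleY A"
    and "\<And>i. fin_dim_subspace scaleX (X i)" and "\<And>i. X i \<subseteq> X (Suc i)"
    and "closure (\<Union>i. X i) = UNIV"
    and "\<And>j. fin_dim_subspace scaleY (Y j)" and "\<And>j. Y j \<subseteq> Y (Suc j)"
    and "closure (\<Union>j. Y j) = UNIV"
  shows
    "let P = ortho_proj ipX (X n);
         Q = ortho_proj ipY (Y m);
         B = Q \<circ> A \<circ> P;
         A_adj = hadjoint ipX ipY A;
         B_adj = hadjoint ipX ipY B;
         decomp1 = (\<lambda>v u. x = v + u \<and> v \<in> range (B_adj \<circ> A) \<and> u \<in> nullspace (B_adj \<circ> A));
         decomp2 = (\<lambda>v u. x = v + u \<and> v \<in> range (A_adj \<circ> B) \<and> u \<in> nullspace (A_adj \<circ> B));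
         decomp3 = (\<lambda>v w q. x = v + w + q \<and> v \<in> range (A_adj \<circ> B)
                      \<and> w \<in> nullspace (Q \<circ> A) \<inter> X n \<and> q \<in> ortho_compl ipX (X n))
     in ((\<exists>!(v, u). decomp1 v u)
         \<and> (\<forall>v u. decomp1 v u \<longrightarrow> v = pseudoinverse B (A x)))
        \<and>
        ((\<exists>!(v, u). decomp2 v u) \<and> (\<exists>!(v, w, q). decomp3 v w q)
         \<and> (\<forall>v u v' w q. decomp2 v u \<and> decomp3 v' w q \<longrightarrow>
              v' = v \<and> v = A_adj (pseudoinverse B_adj x)
              \<and> w = ortho_proj ipX (nullspace (Q \<circ> A) \<inter> X n) x))"
proof -
  interpret X: hilbert_space scaleX ipX by (rule assms)
  interpret Y: hilbert_space scaleY ipY by (rule assms)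
  note Xn = assms(4)[of n] and Ym = assms(7)[of m]
  define P where "P = ortho_proj ipX (X n)"
  define Q where "Q = ortho_proj ipY (Y m)"
  define B where "B = Q \<circ> A \<circ> P"
  define A' where "A' = hadjoint ipX ipY A"
  define B' where "B' = hadjoint ipX ipY B"
  interpret P: adjoint_pair scaleX ipX scaleX ipX P P
    unfolding P_def by (rule X.adjoint_pair_ortho_proj[OF Xn])
  interpret Q: adjoint_pair scaleY ipY scaleY ipY Q Q
    unfolding Q_def by (rule Y.adjoint_pair_ortho_proj[OF Ym])
  interpret A: adjoint_pair scaleX ipX scaleY ipY A A'
    unfolding A'_def by (rule adjoint_pair_hadjoint[OF assms(1-3)])
  interpret A': adjoint_pair scaleY ipY scaleX ipX A' A by (rule A.swap)
  have QA: "adjoint_pair scaleX ipX scaleY ipY (Q \<circ> A) (A' \<circ> Q)"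
    by (rule adjoint_pair_comp[OF A.adjoint_pair_axioms Q.adjoint_pair_axioms])
  have PA': "adjoint_pair scaleY ipY scaleX ipX (P \<circ> A') (A \<circ> P)"
    by (rule adjoint_pair_comp[OF A'.adjoint_pair_axioms P.adjoint_pair_axioms])
  \<comment> \<open>The adjoint of the composition is read off factor by factor;
    \<open>hadjoint_eq\<close> then turns it into a formula for \<open>B'\<close>.\<close>
  have BB: "adjoint_pair scaleX ipX scaleY ipY B (P \<circ> (A' \<circ> Q))"
    unfolding B_def by (rule adjoint_pair_comp[OF P.adjoint_pair_axioms QA])
  have B'_eq: "B' = P \<circ> A' \<circ> Q"
    unfolding B'_def adjoint_pair.hadjoint_eq[OF BB] by (simp add: comp_assoc)
  have range_P: "range P = X n" unfolding P_def by (rule X.range_ortho_proj[OF Xn])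
  have range_Q: "range Q = Y m" unfolding Q_def by (rule Y.range_ortho_proj[OF Ym])
  have P_id: "P z = z" if "z \<in> X n" for z
    using that unfolding P_def by (rule X.ortho_proj_ident[OF Xn])
  have Q_id: "Q z = z" if "z \<in> Y m" for z
    using that unfolding Q_def by (rule Y.ortho_proj_ident[OF Ym])
  have P_mem: "P z \<in> X n" and Q_mem: "Q w \<in> Y m" for z w
    using range_P range_Q by auto
  have "range B = (Q \<circ> A) ` X n" unfolding B_def range_P[symmetric] by auto
  then have fB: "fin_dim_subspace scaleY (range B)"
    using fin_dim_subspace_linear_image[OF adjoint_pair.linear[OF QA] Xn] by simp
  have "range B' = (P \<circ> A') ` Y m" unfolding B'_eq range_Q[symmetric] by auto
  then have fB': "fin_dim_subspace scaleX (range B')"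
    using fin_dim_subspace_linear_image[OF adjoint_pair.linear[OF PA'] Ym] by simp
  interpret B: finite_rank_adjoint_pair scaleX ipX scaleY ipY B B'
    using BB fB fB' unfolding B'_eq
    by (simp add: finite_rank_adjoint_pair_def finite_rank_adjoint_pair_axioms_def comp_assoc)
  interpret B': finite_rank_adjoint_pair scaleY ipY scaleX ipX B' B by (rule B.finite_rank_swap)

  \<comment> \<open>Relations between \<open>A\<close>, \<open>B\<close> and their adjoints\<close>
  have B'_X: "B' y \<in> X n" and B_Y: "B z \<in> Y m" for y z
    by (simp_all add: B'_eq B_def P_mem Q_mem)
  have B'A: "B' (A z) = B' (B z)" if "z \<in> X n" for z
    using that by (simp add: B'_eq B_def P_id Q_id[OF Q_mem])
  have BA': "B (A' y) = B (B' y)" if "y \<in> Y m" for y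
    using that by (simp add: B'_eq B_def Q_id P_id[OF P_mem])
  have A'B_perp: "ipX (A' (B z)) w = 0" if "w \<in> nullspace (Q \<circ> A)" for z w
  proof -
    have "ipX (A' (B z)) w = ipY (Q (B z)) (A w)" by (simp add: A'.adjoint Q_id[OF B_Y])
    also have "\<dots> = ipY (B z) (Q (A w))" by (rule Q.adjoint)
    also have "\<dots> = 0" using that by (simp add: nullspace_def)
    finally show ?thesis .
  qed

  define d1 where "d1 = (\<lambda>v u. x = v + u \<and> v \<in> range (B' \<circ> A) \<and> u \<in> nullspace (B' \<circ> A))"
  define d2 where "d2 = (\<lambda>v u. x = v + u \<and> v \<in> range (A' \<circ> B) \<and> u \<in> nullspace (A' \<circ> B))"
  define d3 where "d3 = (\<lambda>v w q. x = v + w + q \<and> v \<in> range (A' \<circ> B)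
    \<and> w \<in> nullspace (Q \<circ> A) \<inter> X n \<and> q \<in> ortho_compl ipX (X n))"
  define a where "a = pseudoinverse B (A x)"
  define y where "y = pseudoinverse B' x"
  \<comment> \<open>The remainder \<open>x - A' y\<close> of the second decomposition splits into
    its component in \<open>X n\<close>, namely \<open>w\<close>, and the orthogonal rest
    \<open>q\<close>.\<close>
  define w where "w = P (x - A' y)"
  define q where "q = x - A' y - w"

  have a: "a \<in> range B'" "B' (B a) = B' (A x)"
    using B.normal_eq_solution[of "A x"] B.pseudoinverse_eq unfolding a_def by metis+
  have y: "y \<in> range B" "B (B' y) = B x"
    using B'.normal_eq_solution[of x] B'.pseudoinverse_eq unfolding y_def by metis+
  from y(1) have y_Y: "y \<in> Y m" using B_Y by blast
  \<comment> \<open>The normal equation for \<open>B'\<close> becomes a statement about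
    \<open>A'\<close>, since \<open>y\<close> lies in \<open>Y m\<close>.\<close>
  have B_res: "B (x - A' y) = 0" using y(2) by (simp add: B.T.diff BA'[OF y_Y])

  \<comment> \<open>First decomposition\<close>
  have ex1: "d1 a (x - a)"
  proof -
    obtain r where r: "a = B' r" using a(1) by blast
    \<comment> \<open>Membership of \<open>a\<close> in the range of \<open>B'\<close> must be
      sharpened to the range of \<open>B' \<circ> A\<close>. Modulo the nullspace of
      \<open>B'\<close>, \<open>r\<close> is some \<open>B z\<close>; replacing \<open>z\<close> by
      \<open>P z\<close> lets \<open>A\<close> take the place of \<open>B\<close>.\<close>
    obtain z where z: "B' (r - B z) = 0" using B'.range_adjoint_null_decomp[of r] by blast
    then have "a = B' (B (P z))"
      by (simp add: r B'.T.diff) (simp add: B_def P_id[OF P_mem])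
    then have "a = (B' \<circ> A) (P z)" by (simp add: B'A[OF P_mem])
    moreover have "B' (A (x - a)) = 0"
      using a(2) B'A[of a] B'_X r by (simp add: A.T.diff B'.T.diff)
    ultimately show ?thesis unfolding d1_def nullspace_def by auto
  qed
  have uniq1: "v = a" if "d1 v u" for v u
  proof -
    from that obtain z where z: "v = B' (A z)" and u: "B' (A u) = 0" and x: "x = v + u"
      unfolding d1_def nullspace_def by auto
    \<comment> \<open>As an element of \<open>X n\<close>, \<open>v\<close> satisfies the normal
      equation that characterizes the pseudoinverse of \<open>B\<close> at
      \<open>A x\<close>.\<close>
    have "B' (B v) = B' (A x)"
      using B'A[of v] B'_X z u by (simp add: x A.T.add B'.T.add)
    then show ?thesis using B.pseudoinverse_eq[of v "A x"] z unfolding a_def by simp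
  qed

  \<comment> \<open>Second decomposition\<close>
  have null2: "nullspace (A' \<circ> B) = nullspace B"
  proof -
    have "B z = 0" if "A' (B z) = 0" for z
    proof -
      have "B' (B z) = 0" using that by (simp add: B'_eq Q_id[OF B_Y])
      then show ?thesis by (rule B.normal_eq_0)
    qed
    then show ?thesis by (auto simp: nullspace_def)
  qed
  have ex2: "d2 (A' y) (x - A' y)"
    using y(1) B_res unfolding d2_def null2 nullspace_def by auto
  \<comment> \<open>Writing \<open>v = A' (B z)\<close>, the vector \<open>B z\<close> solves the
    normal equation of \<open>B'\<close> for \<open>x\<close> and so equals \<open>y\<close>. The
    second and third decompositions both reduce to this, which is why they share
    \<open>v\<close>.\<close>
  have uniq: "v = A' y" if "v \<in> range (A' \<circ> B)" "B (x - v) = 0" for v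
  proof -
    from that(1) obtain z where z: "v = A' (B z)" by auto
    have "B (B' (B z)) = B x" using that(2) by (simp add: z B.T.diff BA'[OF B_Y])
    then show ?thesis using B'.pseudoinverse_eq[of "B z" x] z unfolding y_def by simp
  qed
  have uniq2: "v = A' y" if "d2 v u" for v u
  proof (rule uniq)
    show "v \<in> range (A' \<circ> B)" using that by (simp add: d2_def)
    have "u = x - v" "u \<in> nullspace B" using that by (simp_all add: d2_def null2)
    then show "B (x - v) = 0" by (simp add: nullspace_def)
  qed

  \<comment> \<open>Third decomposition\<close>
  have B_w: "B w = B (x - A' y)" by (simp add: B_def w_def P_id[OF P_mem])
  have ex3: "d3 (A' y) w q"
  proof -
    have "w \<in> X n" by (simp add: w_def P_mem)
    moreover from this have "Q (A w) = 0" using B_w B_res by (simp add: B_def P_id)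
    moreover have "q \<in> ortho_compl ipX (X n)"
      unfolding q_def w_def P_def ortho_compl_def using X.ortho_proj_fin_dim(2)[OF Xn] by blast
    moreover have "A' y \<in> range (A' \<circ> B)" using y(1) by auto
    ultimately show ?thesis unfolding d3_def nullspace_def by (simp add: q_def)
  qed
  let ?Z = "nullspace (Q \<circ> A) \<inter> X n"
  have uniq3: "v = A' y \<and> w' = ortho_proj ipX ?Z x" if d: "d3 v w' q'" for v w' q'
  proof -
    from d have x: "x = v + w' + q'" and v: "v \<in> range (A' \<circ> B)"
      and w': "Q (A w') = 0" "w' \<in> X n" and q': "\<And>z. z \<in> X n \<Longrightarrow> ipX q' z = 0"
      unfolding d3_def nullspace_def ortho_compl_def by auto
    have "P q' = 0"
      using X.ip_self_eq_0_iff[of "P q'"] P.adjoint[of q' "P q'"] q'[OF P_mem] by metis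
    \<comment> \<open>Here \<open>x - v = w' + q'\<close>: \<open>B\<close> kills \<open>q'\<close>
      through \<open>P\<close>, and \<open>w'\<close> because \<open>P\<close> fixes it and
      \<open>Q \<circ> A\<close> annihilates it.\<close>
    then have "B (x - v) = 0"
      by (simp add: x B.T.diff B.T.add) (simp add: B_def P_id w' A.T.zero Q.T.zero)
    with v have "v = A' y" by (rule uniq)
    moreover have "ortho_proj ipX ?Z x = w'"
    proof (rule X.ortho_proj_eq)
      show "y - z \<in> ?Z" if "y \<in> ?Z" "z \<in> ?Z" for y z
        using that X.fin_dim_subspace_diff[OF Xn] by (auto simp: nullspace_def A.T.diff Q.T.diff)
      show "w' \<in> ?Z" using w' by (simp add: nullspace_def)
      \<comment> \<open>The vector \<open>x - w'\<close> is \<open>v + q'\<close>, where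
        \<open>v\<close> is orthogonal to the nullspace of \<open>Q \<circ> A\<close> and
        \<open>q'\<close> to \<open>X n\<close>.\<close>
      have "ipX (x - w') z = 0" if "z \<in> ?Z" for z
        using that v q' A'B_perp by (auto simp: x X.ip_add_left)
      then show "x - w' \<in> ortho_compl ipX ?Z" by (simp add: ortho_compl_def)
    qed
    ultimately show ?thesis by simp
  qed

  have "\<exists>!(v, u). d1 v u"
  proof (rule ex1I[of _ "(a, x - a)"])
    fix p assume "case p of (v, u) \<Rightarrow> d1 v u"
    then obtain v u where p: "p = (v, u)" "d1 v u" by (cases p) auto
    then have "x = v + u" by (simp add: d1_def)
    with uniq1[OF p(2)] p(1) show "p = (a, x - a)" by simp
  qed (simp add: ex1)
  moreover have "\<exists>!(v, u). d2 v u"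
  proof (rule ex1I[of _ "(A' y, x - A' y)"])
    fix p assume "case p of (v, u) \<Rightarrow> d2 v u"
    then obtain v u where p: "p = (v, u)" "d2 v u" by (cases p) auto
    then have "x = v + u" by (simp add: d2_def)
    with uniq2[OF p(2)] p(1) show "p = (A' y, x - A' y)" by simp
  qed (simp add: ex2)
  moreover have "\<exists>!(v, w, q). d3 v w q"
  proof (rule ex1I[of _ "(A' y, w, q)"])
    fix p assume "case p of (v, w, q) \<Rightarrow> d3 v w q"
    then obtain v w' q' where p: "p = (v, w', q')" "d3 v w' q'" by (cases p) auto
    then have "q' = x - v - w'" by (simp add: d3_def)
    \<comment> \<open>Both \<open>w'\<close> and \<open>w\<close> equal the same projection of
      \<open>x\<close>, by \<open>uniq3\<close> applied to the given decomposition and to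
      \<open>ex3\<close>.\<close>
    moreover have "v = A' y" "w' = w" using uniq3[OF p(2)] uniq3[OF ex3] by simp_all
    ultimately show "p = (A' y, w, q)" using p(1) by (simp add: q_def)
  qed (simp add: ex3)
  moreover have "\<forall>v u. d1 v u \<longrightarrow> v = a" using uniq1 by blast
  moreover have "\<forall>v u v' w q. d2 v u \<and> d3 v' w q \<longrightarrow>
      v' = v \<and> v = A' y \<and> w = ortho_proj ipX ?Z x"
  proof (intro allI impI)
    fix v u v' w q assume "d2 v u \<and> d3 v' w q"
    with uniq2[of v u] uniq3[of v' w q]
    show "v' = v \<and> v = A' y \<and> w = ortho_proj ipX ?Z x" by simp
  qed
  ultimately show ?thesis
    unfolding Let_def d1_def d2_def d3_def a_def y_def B'_def A'_def B_def P_def Q_def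
    by (intro conjI)
qed

end
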